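(* Let $L$ be an involutive division on $\mathbb{M}$ and $\succ$ an admissible monomial ordering. Let $F\subset R$ be a finite $L$-autoreduced polynomial set, and let $g\cdot x$ be a non-multiplicative prolongation of $g\in F$, i.e. $x\in NM_L(lm(g),lm(F))$. Then $NF_L(g\cdot x,F)=0$ if the following two conditions hold: (1) for all $h\in F$ and all $u\in\mathbb{M}$ with $lm(h)\cdot u\prec lm(g\cdot x)$ one has $NF_L(h\cdot u,F)=0$; (2) there exist $f,f_0,g_0\in F$ such that $lm(f_0)\mid lm(f)$, $lm(g_0)\mid lm(g)$, $lm(f)\,|_L\,lm(g\cdot x)$, $\operatorname{lcm}(lm(f_0),lm(g_0))\prec lm(g\cdot x)$, and $$NF_L\Bigl(f_0\cdot\tfrac{lt(f)}{lt(f_0)},F\Bigr)=NF_L\Bigl(g_0\cdot\tfrac{lt(g)}{lt(g_0)},F\Bigr)=0 .$$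
   Context: $R=K[x_1,\dots,x_n]$ with $K$ a field of characteristic zero; $\mathbb{M}$ is the monoid of monomials. $\succ$ is an admissible monomial ordering with $x_1\succ\cdots\succ x_n$; $lt(f)$, $lc(f)$, $lm(f)=lt(f)/lc(f)$ are the leading term, leading coefficient and leading monomial of $f$; $lm(F)=\{lm(f)\mid f\in F\}$. Involutive division: $L$ is given if for any finite $U\subset\mathbb{M}$ and any $u\in U$ there is given a submonoid $L(u,U)$ of $\mathbb{M}$ such that (a) if $w\in L(u,U)$ and $v\mid w$, then $v\in L(u,U)$; (b) if $u,v\in U$ and $uL(u,U)\cap vL(v,U)\ne\emptyset$, then $u\in vL(v,U)$ or $v\in uL(u,U)$; (c) if $v\in U$ and $v\in uL(u,U)$, then $L(v,U)\subseteq L(u,U)$; (d) if $V\subseteq U$, then $L(u,U)\subseteq L(u,V)$ for all $u\in V$. For $u\in U$, $u|_L w$ means $w\in uL(u,U)$ (for leading monomials of elements of $F$, $U=lm(F)$). The variables in $L(u,U)$ are multiplicative for $u$; $NM_L(u,U)$ is the set of the remaining (non-multiplicative) variables. $C_L(U)=\bigcup_{u\in U}uL(u,U)$. $U$ is $L$-autoreduced if no element of $U$ is $L$-divisible (w.r.t. $U$) by another element of $U$. $L$-autoreduced polynomial set: a finite set $F$ of nonzero polynomials with pairwise distinct leading monomials such that $lm(F)$ is $L$-autoreduced and no $f\in F$ has a term with nonzero coefficient, other than $lt(f)$, whose monomial lies in $C_L(lm(F))$. Involutive reduction: $p$ is $L$-reducible modulo $f\in F$ if $p$ has a term $a\,u$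 ($a\in K$, $a\neq0$, $u\in\mathbb{M}$) with $u=lm(f)v$, $v\in L(lm(f),lm(F))$; the corresponding $L$-reduction is $p\to p-(a/lc(f))\,f v$. $p$ is in $L$-normal form modulo $F$ if it is not $L$-reducible modulo any $f\in F$. $NF_L(p,F)$ denotes an $L$-normal form of $p$ modulo $F$, i.e. a polynomial in $L$-normal form modulo $F$ obtained from $p$ by a finite chain of $L$-reductions modulo $F$, chosen by an arbitrary fixed algorithm. *)

theory Defs
  imports Complex_Main "HOL-Library.Poly_Mapping"
begin

text \<open>
  Monomials are exponent vectors, so the monoid of monomials is written additively:
  the product of monomials is \<open>+\<close>, the trivial monomial is \<open>0\<close>, and a quotient
  \<open>w / u\<close> with \<open>u\<close> dividing \<open>w\<close> is \<open>w - u\<close>. The library order on \<open>\<Rightarrow>\<^sub>0\<close> is never used;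
  the monomial ordering is an explicit strict relation \<open>prec\<close>.
  The variables \<open>x\<^sub>1, \<dots>, x\<^sub>n\<close> are indexed by a finite linearly ordered type \<open>'n\<close>.
\<close>

type_synonym 'n mon = "'n \<Rightarrow>\<^sub>0 nat"
type_synonym ('n, 'k) mpol = "'n mon \<Rightarrow>\<^sub>0 'k"
type_synonym 'n division = "'n mon \<Rightarrow> 'n mon set \<Rightarrow> 'n mon set"

definition var :: "'n \<Rightarrow> 'n mon" where
  "var i = Poly_Mapping.single i 1"

definition mon_poly :: "'n mon \<Rightarrow> ('n, 'k::field) mpol" where
  "mon_poly u = Poly_Mapping.single u 1"

definition mon_dvd :: "'n mon \<Rightarrow> 'n mon \<Rightarrow> bool" where
  "mon_dvd u w \<longleftrightarrow> (\<exists>v. w = u + v)"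

lift_definition mon_lcm :: "'n::finite mon \<Rightarrow> 'n mon \<Rightarrow> 'n mon"
  is "\<lambda>u v i. max (u i) (v i)"
  by simp

definition admissible_ordering :: "('n mon \<Rightarrow> 'n mon \<Rightarrow> bool) \<Rightarrow> bool" where
  "admissible_ordering prec \<longleftrightarrow>
     (\<forall>u. \<not> prec u u) \<and>
     (\<forall>u v w. prec u v \<longrightarrow> prec v w \<longrightarrow> prec u w) \<and>
     (\<forall>u v. prec u v \<or> u = v \<or> prec v u) \<and>
     (\<forall>u. u \<noteq> 0 \<longrightarrow> prec 0 u) \<and>
     (\<forall>u v w. prec u v \<longrightarrow> prec (u + w) (v + w))"

text \<open>The following three are meaningful only for nonzero polynomials.\<close>

definition lm :: "('n mon \<Rightarrow> 'n mon \<Rightarrow> bool) \<Rightarrow> ('n, 'k::field) mpol \<Rightarrow> 'n mon" where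
  "lm prec p = (THE u. u \<in> Poly_Mapping.keys p \<and>
                       (\<forall>v\<in>Poly_Mapping.keys p. v \<noteq> u \<longrightarrow> prec v u))"

definition lc :: "('n mon \<Rightarrow> 'n mon \<Rightarrow> bool) \<Rightarrow> ('n, 'k::field) mpol \<Rightarrow> 'k" where
  "lc prec p = Poly_Mapping.lookup p (lm prec p)"

definition lt :: "('n mon \<Rightarrow> 'n mon \<Rightarrow> bool) \<Rightarrow> ('n, 'k::field) mpol \<Rightarrow> ('n, 'k) mpol" where
  "lt prec p = Poly_Mapping.single (lm prec p) (lc prec p)"

text \<open>
  The term \<open>lt(p) / lt(q)\<close>. Exponents are subtracted with truncation, so this is the
  quotient only if \<open>lm(q)\<close> divides \<open>lm(p)\<close>; see lemma \<open>lt_quot_mult\<close> below.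
\<close>

definition lt_quot ::
  "('n mon \<Rightarrow> 'n mon \<Rightarrow> bool) \<Rightarrow> ('n, 'k::field) mpol \<Rightarrow> ('n, 'k) mpol \<Rightarrow> ('n, 'k) mpol" where
  "lt_quot prec p q = Poly_Mapping.single (lm prec p - lm prec q) (lc prec p / lc prec q)"

text \<open>Only the values \<open>L u U\<close> with \<open>U\<close> finite and \<open>u \<in> U\<close> carry information.\<close>

definition involutive_division :: "'n division \<Rightarrow> bool" where
  "involutive_division L \<longleftrightarrow> (\<forall>U. finite U \<longrightarrow>
     (\<forall>u\<in>U. 0 \<in> L u U \<and> (\<forall>v\<in>L u U. \<forall>w\<in>L u U. v + w \<in> L u U)) \<and>
     (\<forall>u\<in>U. \<forall>w\<in>L u U. \<forall>v. mon_dvd v w \<longrightarrow> v \<in> L u U) \<and>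
     (\<forall>u\<in>U. \<forall>v\<in>U. (+) u ` L u U \<inter> (+) v ` L v U \<noteq> {} \<longrightarrow>
                    u \<in> (+) v ` L v U \<or> v \<in> (+) u ` L u U) \<and>
     (\<forall>u\<in>U. \<forall>v\<in>U. v \<in> (+) u ` L u U \<longrightarrow> L v U \<subseteq> L u U) \<and>
     (\<forall>V\<subseteq>U. \<forall>u\<in>V. L u U \<subseteq> L u V))"

definition L_dvd :: "'n division \<Rightarrow> 'n mon set \<Rightarrow> 'n mon \<Rightarrow> 'n mon \<Rightarrow> bool" where
  "L_dvd L U u w \<longleftrightarrow> w \<in> (+) u ` L u U"

definition NM :: "'n division \<Rightarrow> 'n mon \<Rightarrow> 'n mon set \<Rightarrow> 'n set" where
  "NM L u U = {i. var i \<notin> L u U}"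

definition L_cone :: "'n division \<Rightarrow> 'n mon set \<Rightarrow> 'n mon set" where
  "L_cone L U = (\<Union>u\<in>U. (+) u ` L u U)"

definition L_autoreduced_mon :: "'n division \<Rightarrow> 'n mon set \<Rightarrow> bool" where
  "L_autoreduced_mon L U \<longleftrightarrow> (\<forall>u\<in>U. \<forall>v\<in>U. u \<noteq> v \<longrightarrow> \<not> L_dvd L U v u)"

definition L_autoreduced ::
  "('n mon \<Rightarrow> 'n mon \<Rightarrow> bool) \<Rightarrow> 'n division \<Rightarrow> ('n, 'k::field) mpol set \<Rightarrow> bool" where
  "L_autoreduced prec L F \<longleftrightarrow>
     finite F \<and> 0 \<notin> F \<and> inj_on (lm prec) F \<and> L_autoreduced_mon L (lm prec ` F) \<and>
     (\<forall>f\<in>F. \<forall>u\<in>Poly_Mapping.keys f. u \<noteq> lm prec f \<longrightarrow> u \<notin> L_cone L (lm prec ` F))"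

definition L_red ::
  "('n mon \<Rightarrow> 'n mon \<Rightarrow> bool) \<Rightarrow> 'n division \<Rightarrow> ('n, 'k::field) mpol set \<Rightarrow>
   ('n, 'k) mpol \<Rightarrow> ('n, 'k) mpol \<Rightarrow> bool" where
  "L_red prec L F p q \<longleftrightarrow>
     (\<exists>f\<in>F. \<exists>u\<in>Poly_Mapping.keys p. \<exists>v\<in>L (lm prec f) (lm prec ` F).
        u = lm prec f + v \<and>
        q = p - Poly_Mapping.single v (Poly_Mapping.lookup p u / lc prec f) * f)"

definition L_normal ::
  "('n mon \<Rightarrow> 'n mon \<Rightarrow> bool) \<Rightarrow> 'n division \<Rightarrow> ('n, 'k::field) mpol set \<Rightarrow>
   ('n, 'k) mpol \<Rightarrow> bool" where
  "L_normal prec L F p \<longleftrightarrow>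
     \<not> (\<exists>f\<in>F. \<exists>u\<in>Poly_Mapping.keys p. \<exists>v\<in>L (lm prec f) (lm prec ` F). u = lm prec f + v)"

text \<open>
  A normal form algorithm modulo \<open>F\<close> is an arbitrary choice function: each polynomial is
  sent to some polynomial in normal form that a finite chain of reductions leads to.
\<close>

definition L_normal_form_algorithm ::
  "('n mon \<Rightarrow> 'n mon \<Rightarrow> bool) \<Rightarrow> 'n division \<Rightarrow> ('n, 'k::field) mpol set \<Rightarrow>
   (('n, 'k) mpol \<Rightarrow> ('n, 'k) mpol) \<Rightarrow> bool" where
  "L_normal_form_algorithm prec L F NF \<longleftrightarrow>
     (\<forall>p. (L_red prec L F)\<^sup>*\<^sup>* p (NF p) \<and> L_normal prec L F (NF p))"

lemma lm_props:
  assumes "admissible_ordering prec" and "p \<noteq> 0"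
  shows "lm prec p \<in> Poly_Mapping.keys p"
    and "\<And>v. v \<in> Poly_Mapping.keys p \<Longrightarrow> v \<noteq> lm prec p \<Longrightarrow> prec v (lm prec p)"
proof -
  have tr: "prec u v \<Longrightarrow> prec v w \<Longrightarrow> prec u w" and ir: "\<not> prec u u"
    and tot: "prec u v \<or> u = v \<or> prec v u" for u v w
    using assms(1) unfolding admissible_ordering_def by blast+
  have max: "\<exists>u\<in>A. \<forall>v\<in>A. v \<noteq> u \<longrightarrow> prec v u" if "finite A" "A \<noteq> {}" for A
    using that
  proof (induction rule: finite_ne_induct)
    case (insert a A)
    then obtain m where m: "m \<in> A" "\<forall>v\<in>A. v \<noteq> m \<longrightarrow> prec v m" by blast
    show ?case
    proof (cases "prec m a")
      case True
      then have "\<forall>v\<in>insert a A. v \<noteq> a \<longrightarrow> prec v a"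
        using m tr[of _ m a] by (metis insertE)
      then show ?thesis by blast
    next
      case False
      then have "\<forall>v\<in>insert a A. v \<noteq> m \<longrightarrow> prec v m" using m tot[of m a] by auto
      then show ?thesis using m by blast
    qed
  qed simp
  obtain m where m: "m \<in> Poly_Mapping.keys p" "\<forall>v\<in>Poly_Mapping.keys p. v \<noteq> m \<longrightarrow> prec v m"
    using max[of "Poly_Mapping.keys p"] assms(2) by auto
  have "\<exists>!u. u \<in> Poly_Mapping.keys p \<and> (\<forall>v\<in>Poly_Mapping.keys p. v \<noteq> u \<longrightarrow> prec v u)"
  proof (rule ex1I[of _ m])
    fix u assume "u \<in> Poly_Mapping.keys p \<and> (\<forall>v\<in>Poly_Mapping.keys p. v \<noteq> u \<longrightarrow> prec v u)"
    then show "u = m" using m tr[of u m u] ir[of u] by metis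
  qed (use m in blast)
  from theI'[OF this] show "lm prec p \<in> Poly_Mapping.keys p"
    and "\<And>v. v \<in> Poly_Mapping.keys p \<Longrightarrow> v \<noteq> lm prec p \<Longrightarrow> prec v (lm prec p)"
    unfolding lm_def by blast+
qed

lemma lt_quot_mult:
  assumes "admissible_ordering prec" and "q \<noteq> 0" and "mon_dvd (lm prec q) (lm prec p)"
  shows "lt_quot prec p q * lt prec q = lt prec p"
proof -
  have "lc prec q \<noteq> 0"
    using lm_props(1)[OF assms(1,2)] by (simp add: lc_def in_keys_iff)
  then show ?thesis
    using assms(3) by (auto simp: lt_quot_def lt_def mult_single mon_dvd_def add.commute)
qed

lemma mon_lcm_least:
  "mon_dvd u (mon_lcm u v)" "mon_dvd v (mon_lcm u v)"
  "mon_dvd u w \<Longrightarrow> mon_dvd v w \<Longrightarrow> mon_dvd (mon_lcm u v) w"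
proof -
  have dvd_iff: "mon_dvd a b \<longleftrightarrow> (\<forall>i. Poly_Mapping.lookup a i \<le> Poly_Mapping.lookup b i)" for a b :: "'a mon"
  proof
    assume "\<forall>i. Poly_Mapping.lookup a i \<le> Poly_Mapping.lookup b i"
    then have "b = a + (b - a)"
      by (intro poly_mapping_eqI) (simp add: lookup_add lookup_minus)
    then show "mon_dvd a b" unfolding mon_dvd_def by blast
  qed (auto simp: mon_dvd_def lookup_add)
  show "mon_dvd u (mon_lcm u v)" "mon_dvd v (mon_lcm u v)"
    "mon_dvd u w \<Longrightarrow> mon_dvd v w \<Longrightarrow> mon_dvd (mon_lcm u v) w"
    by (simp_all add: dvd_iff mon_lcm.rep_eq)
qed

end

theory Submission
  imports Defs
begin

text \<open>
  Let \<open>S\<close> be the \<open>K\<close>-linear span of all multiplicative prolongations \<open>f \<cdot> v\<close>, where \<open>f \<in> F\<close>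
  and \<open>v \<in> L(lm f, lm F)\<close>. Since \<open>F\<close> is autoreduced, the cones \<open>lm f \<cdot> L(lm f, lm F)\<close> are disjoint,
  so the multiplicative prolongations have pairwise distinct leading monomials. In a nontrivial linear
  combination the largest of these survives, hence a nonzero element of \<open>S\<close> is never in normal form.
  As reductions only subtract elements of \<open>S\<close>, the condition \<open>NF p = 0\<close> is the linear condition
  \<open>p \<in> S\<close> (lemma \<open>NF_eq_0_iff\<close>), whatever the choices made by \<open>NF\<close>.

  Write \<open>w = lm (g \<cdot> x)\<close>. Suppose that nonzero \<open>p, q \<in> S\<close> have the same leading monomial \<open>m\<close>,
  where \<open>w = m \<cdot> s\<close>. The combination of \<open>p\<close> and \<open>q\<close> that cancels the leading terms lies in \<open>S\<close>, and the
  chain of reductions taking it to \<open>0\<close> writes it with multiplicative prolongations whose leading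
  monomials are smaller than \<open>m\<close>. Multiplied by \<open>s\<close>, they become prolongations below \<open>w\<close>, which lie
  in \<open>S\<close> by the first hypothesis. Therefore \<open>p \<cdot> s \<in> S\<close> if and only if \<open>q \<cdot> s \<in> S\<close>
  (lemma \<open>monomial_multiple_transfer\<close>).

  This transfer carries membership from \<open>f\<close> to \<open>g\<close> along \<open>f \<rightarrow> f\<^sub>0 \<rightarrow> g\<^sub>0 \<rightarrow> g\<close>. The multiplicative
  prolongation of \<open>f\<close> with leading monomial \<open>w\<close> is in \<open>S\<close>. Comparing \<open>f\<close> with \<open>f\<^sub>0 \<cdot> lt f / lt f\<^sub>0\<close>, then
  the prolongations of \<open>f\<^sub>0\<close> and \<open>g\<^sub>0\<close> that meet in \<open>lcm (lm f\<^sub>0, lm g\<^sub>0)\<close>, and finally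
  \<open>g\<^sub>0 \<cdot> lt g / lt g\<^sub>0\<close> with \<open>g\<close>, one obtains \<open>g \<cdot> x \<in> S\<close>. The middle comparison is the argument behind
  Buchberger's chain criterion: the S-polynomial of \<open>f\<^sub>0\<close> and \<open>g\<^sub>0\<close> is harmless because their least
  common multiple is below \<open>w\<close>.
\<close>

section \<open>Leading monomials and multiplication by a term\<close>

lemma lookup_term_mult:
  fixes p :: "('n, 'k::field) mpol"
  shows "Poly_Mapping.lookup (Poly_Mapping.single v c * p) (v + u) = c * Poly_Mapping.lookup p u"
  by (simp add: lookup_mult lookup_single when_mult)

lemma lookup_scalar_mult:
  fixes p :: "('n, 'k::field) mpol"
  shows "Poly_Mapping.lookup (Poly_Mapping.single 0 c * p) u = c * Poly_Mapping.lookup p u"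
  using lookup_term_mult[of 0 c p u] by simp

lemma keys_term_mult:
  fixes p :: "('n, 'k::field) mpol"
  assumes "c \<noteq> 0"
  shows "Poly_Mapping.keys (Poly_Mapping.single v c * p) = (+) v ` Poly_Mapping.keys p"
proof
  show "Poly_Mapping.keys (Poly_Mapping.single v c * p) \<subseteq> (+) v ` Poly_Mapping.keys p"
    using keys_mult[of "Poly_Mapping.single v c" p] assms by auto
  show "(+) v ` Poly_Mapping.keys p \<subseteq> Poly_Mapping.keys (Poly_Mapping.single v c * p)"
    using assms by (auto simp: in_keys_iff lookup_term_mult)
qed

lemma term_mult_neq_0:
  fixes p :: "('n, 'k::field) mpol"
  assumes "c \<noteq> 0" "p \<noteq> 0"
  shows "Poly_Mapping.single v c * p \<noteq> 0"
  using keys_term_mult[OF assms(1), of v p] assms(2) by (metis image_is_empty keys_eq_empty)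

lemma admissible_orderingD:
  assumes "admissible_ordering prec"
  shows "\<not> prec u u"
    and "prec u v \<Longrightarrow> prec v w \<Longrightarrow> prec u w"
    and "prec u v \<Longrightarrow> prec (u + w) (v + w)"
  using assms unfolding admissible_ordering_def by blast+

lemma lm_eqI:
  assumes "admissible_ordering prec" "u \<in> Poly_Mapping.keys p"
    and "\<And>v. v \<in> Poly_Mapping.keys p \<Longrightarrow> v \<noteq> u \<Longrightarrow> prec v u"
  shows "lm prec p = u"
proof -
  have "p \<noteq> 0" using assms(2) by auto
  then show ?thesis
    using lm_props[OF assms(1)] assms(2,3) admissible_orderingD(1,2)[OF assms(1)] by metis
qed

lemma lm_term_mult:
  fixes p :: "('n, 'k::field) mpol"
  assumes "admissible_ordering prec" "c \<noteq> 0" "p \<noteq> 0"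
  shows "lm prec (Poly_Mapping.single v c * p) = lm prec p + v"
proof (rule lm_eqI[OF assms(1)])
  show "lm prec p + v \<in> Poly_Mapping.keys (Poly_Mapping.single v c * p)"
    using lm_props(1)[OF assms(1,3)] by (auto simp: keys_term_mult[OF assms(2)] add.commute)
next
  fix u assume "u \<in> Poly_Mapping.keys (Poly_Mapping.single v c * p)" "u \<noteq> lm prec p + v"
  then show "prec u (lm prec p + v)"
    using lm_props(2)[OF assms(1,3)] admissible_orderingD(3)[OF assms(1), of _ "lm prec p" v]
    by (auto simp: keys_term_mult[OF assms(2)] add.commute[of v])
qed

lemma lc_neq_0: "admissible_ordering prec \<Longrightarrow> p \<noteq> 0 \<Longrightarrow> lc prec p \<noteq> 0"
  by (metis lc_def lm_props(1) lookup_eq_zero_in_keys_contradict)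

lemma mon_dvd_add_diff: "mon_dvd u w \<Longrightarrow> u + (w - u) = w"
  by (auto simp: mon_dvd_def)

lemma mon_dvd_trans: "mon_dvd u v \<Longrightarrow> mon_dvd v w \<Longrightarrow> mon_dvd u w"
  by (auto simp: mon_dvd_def add.assoc)

lemma mon_quotients_add:
  assumes "mon_dvd u v" "mon_dvd v w"
  shows "(w - v) + (v - u) = w - u"
proof -
  obtain a b where "v = u + a" "w = v + b" using assms by (auto simp: mon_dvd_def)
  moreover from this have "w = u + (a + b)" by (simp add: add.assoc)
  ultimately show ?thesis by (metis add.commute add_diff_cancel_left')
qed

section \<open>The span of the multiplicative prolongations\<close>

interpretation mpol: vector_space "\<lambda>(c::'k::field) (p::('n, 'k) mpol). Poly_Mapping.single 0 c * p"
  by unfold_locales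
    (simp_all add: distrib_left single_add distrib_right mult_single mult.assoc[symmetric])

lemma span_scalar_mult_iff:
  fixes p :: "('n, 'k::field) mpol"
  assumes "c \<noteq> 0"
  shows "Poly_Mapping.single 0 c * p \<in> mpol.span B \<longleftrightarrow> p \<in> mpol.span B"
proof
  assume "Poly_Mapping.single 0 c * p \<in> mpol.span B"
  then have "Poly_Mapping.single 0 (1 / c) * (Poly_Mapping.single 0 c * p) \<in> mpol.span B"
    by (rule mpol.span_scale)
  then show "p \<in> mpol.span B"
    using assms by (simp add: mult.assoc[symmetric] mult_single)
qed (rule mpol.span_scale)

text \<open>
  The leading monomials are restricted to a set \<open>D\<close> so that a span bounded by a monomial and the
  full span (\<open>D = UNIV\<close>) are instances of the same notion.
\<close>

definition mult_prolongations ::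
  "('n mon \<Rightarrow> 'n mon \<Rightarrow> bool) \<Rightarrow> 'n division \<Rightarrow> ('n, 'k::field) mpol set \<Rightarrow> 'n mon set \<Rightarrow>
   ('n, 'k) mpol set" where
  "mult_prolongations prec L F D =
     {mon_poly v * f | f v. f \<in> F \<and> v \<in> L (lm prec f) (lm prec ` F) \<and> lm prec f + v \<in> D}"

abbreviation involutive_span ::
  "('n mon \<Rightarrow> 'n mon \<Rightarrow> bool) \<Rightarrow> 'n division \<Rightarrow> ('n, 'k::field) mpol set \<Rightarrow> ('n, 'k) mpol set" where
  "involutive_span prec L F \<equiv> mpol.span (mult_prolongations prec L F UNIV)"

lemma mult_prolongation_in_span:
  assumes "f \<in> F" "v \<in> L (lm prec f) (lm prec ` F)"
  shows "mon_poly v * f \<in> involutive_span prec L F"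
  by (rule mpol.span_base) (use assms in \<open>unfold mult_prolongations_def, blast\<close>)

text \<open>
  In a linear combination, the largest leading monomial of the summands occurs only once and so
  cannot cancel.
\<close>

lemma span_lm_in_keys:
  fixes B :: "('n, 'k::field) mpol set"
  assumes adm: "admissible_ordering prec"
    and B: "0 \<notin> B" "inj_on (lm prec) B"
    and p: "p \<in> mpol.span B" "p \<noteq> 0"
  shows "\<exists>b\<in>B. lm prec b \<in> Poly_Mapping.keys p"
proof -
  obtain r where "p = (\<Sum>b | r b \<noteq> 0. Poly_Mapping.single 0 (r b) * b)"
      "finite {b. r b \<noteq> 0}" "{b. r b \<noteq> 0} \<subseteq> B"
    using p(1) unfolding mpol.span_alt by auto
  then obtain T where r: "p = (\<Sum>b\<in>T. Poly_Mapping.single 0 (r b) * b)"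
      "finite T" "T \<subseteq> B" and rT: "\<And>b. b \<in> T \<Longrightarrow> r b \<noteq> 0"
    by blast
  have "T \<noteq> {}" using r(1) p(2) by auto
  moreover have "asymp_on T (\<lambda>b b'. prec (lm prec b) (lm prec b'))"
    by (rule asymp_onI) (use admissible_orderingD(1,2)[OF adm] in blast)
  moreover have "transp_on T (\<lambda>b b'. prec (lm prec b) (lm prec b'))"
    by (rule transp_onI) (use admissible_orderingD(2)[OF adm] in blast)
  ultimately obtain m where m: "m \<in> T" "\<forall>b\<in>T. b \<noteq> m \<longrightarrow> \<not> prec (lm prec m) (lm prec b)"
    using r(2) Finite_Set.bex_max_element[of T "\<lambda>b b'. prec (lm prec b) (lm prec b')"]
    by auto
  have other: "Poly_Mapping.lookup b (lm prec m) = 0" if b: "b \<in> T" "b \<noteq> m" for b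
  proof (rule ccontr)
    assume "Poly_Mapping.lookup b (lm prec m) \<noteq> 0"
    then have "lm prec m \<in> Poly_Mapping.keys b" by (simp add: in_keys_iff)
    moreover have "lm prec m \<noteq> lm prec b"
      using B(2) b m(1) r(3) by (metis inj_on_contraD subsetD)
    moreover have "b \<noteq> 0" using b(1) r(3) B(1) by auto
    ultimately show False using lm_props(2)[OF adm] m(2) b by blast
  qed
  have "Poly_Mapping.lookup p (lm prec m) = (\<Sum>b\<in>T. r b * Poly_Mapping.lookup b (lm prec m))"
    by (simp add: r(1) lookup_sum lookup_scalar_mult)
  also have "\<dots> = r m * Poly_Mapping.lookup m (lm prec m)"
    using r(2) m(1) other by (simp add: sum.remove[of T m])
  also have "\<dots> \<noteq> 0"
    using m(1) r(3) rT B(1) lc_neq_0[OF adm, of m] by (auto simp: lc_def)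
  finally show ?thesis using m(1) r(3) by (auto simp: in_keys_iff)
qed

lemma involutive_divisionD:
  assumes "involutive_division L" "finite U" "u \<in> U"
  shows "0 \<in> L u U"
    and "v \<in> U \<Longrightarrow> (+) u ` L u U \<inter> (+) v ` L v U \<noteq> {} \<Longrightarrow> L_dvd L U v u \<or> L_dvd L U u v"
proof -
  note U = assms(1)[unfolded involutive_division_def, rule_format, OF assms(2)]
  show "0 \<in> L u U"
    using U[THEN conjunct1] assms(3) by simp
  show "v \<in> U \<Longrightarrow> (+) u ` L u U \<inter> (+) v ` L v U \<noteq> {} \<Longrightarrow> L_dvd L U v u \<or> L_dvd L U u v"
    using U[THEN conjunct2, THEN conjunct2, THEN conjunct1] assms(3) unfolding L_dvd_def by simp
qed

text \<open>
  The second axiom of an involutive division says that overlapping cones are comparable, and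
  autoreducedness excludes that.
\<close>

lemma cones_disjoint:
  assumes "involutive_division L" "L_autoreduced prec L F" "f \<in> F" "f' \<in> F"
    and "v \<in> L (lm prec f) (lm prec ` F)" "v' \<in> L (lm prec f') (lm prec ` F)"
    and eq: "lm prec f + v = lm prec f' + v'"
  shows "f = f'"
proof -
  let ?U = "lm prec ` F"
  have auto: "finite ?U" "inj_on (lm prec) F" "L_autoreduced_mon L ?U"
    using assms(2) by (auto simp: L_autoreduced_def)
  have "lm prec f \<in> ?U" "lm prec f' \<in> ?U" using assms(3,4) by auto
  moreover have "(+) (lm prec f) ` L (lm prec f) ?U \<inter> (+) (lm prec f') ` L (lm prec f') ?U \<noteq> {}"
    using assms(5,6) eq by auto
  ultimately have "L_dvd L ?U (lm prec f') (lm prec f) \<or> L_dvd L ?U (lm prec f) (lm prec f')"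
    by (rule involutive_divisionD(2)[OF assms(1) auto(1)])
  then have "lm prec f = lm prec f'"
    using auto(3) assms(3,4) unfolding L_autoreduced_mon_def by (metis imageI)
  then show ?thesis using auto(2) assms(3,4) by (simp add: inj_on_def)
qed

lemma mult_prolongations_lm_inj:
  assumes "involutive_division L" "admissible_ordering prec" "L_autoreduced prec L F"
  shows "inj_on (lm prec) (mult_prolongations prec L F D)"
    and "0 \<notin> mult_prolongations prec L F D"
proof -
  have F: "f \<noteq> 0" if "f \<in> F" for f using assms(3) that by (auto simp: L_autoreduced_def)
  show "inj_on (lm prec) (mult_prolongations prec L F D)"
  proof (rule inj_onI)
    fix b b'
    assume "b \<in> mult_prolongations prec L F D" "b' \<in> mult_prolongations prec L F D"
      and eq: "lm prec b = lm prec b'"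
    then obtain f v f' v' where b: "b = mon_poly v * f" "b' = mon_poly v' * f'"
      "f \<in> F" "f' \<in> F" "v \<in> L (lm prec f) (lm prec ` F)" "v' \<in> L (lm prec f') (lm prec ` F)"
      unfolding mult_prolongations_def by blast
    then have "lm prec f + v = lm prec f' + v'"
      using eq F lm_term_mult[OF assms(2) one_neq_zero] unfolding mon_poly_def by metis
    moreover from this have "f = f'" using cones_disjoint[OF assms(1,3)] b by blast
    ultimately show "b = b'" using b by simp
  qed
  show "0 \<notin> mult_prolongations prec L F D"
  proof
    assume "0 \<in> mult_prolongations prec L F D"
    then obtain f v where "f \<in> F" "0 = mon_poly v * f"
      unfolding mult_prolongations_def by blast
    then show False using F term_mult_neq_0[OF one_neq_zero] unfolding mon_poly_def by metis
  qed
qed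

text \<open>
  A reduction at a monomial \<open>u\<close> subtracts a multiplicative prolongation with leading monomial \<open>u\<close>.
  It creates only monomials below \<open>u\<close>, so an order ideal \<open>D\<close> that contains the monomials of \<open>p\<close> is
  never left.
\<close>

lemma reduction_chain_in_span:
  fixes F :: "('n, 'k::field) mpol set"
  assumes adm: "admissible_ordering prec" and F: "0 \<notin> F"
    and D: "\<And>u v. u \<in> D \<Longrightarrow> prec v u \<Longrightarrow> v \<in> D"
    and red: "(L_red prec L F)\<^sup>*\<^sup>* p q" and p: "Poly_Mapping.keys p \<subseteq> D"
  shows "p - q \<in> mpol.span (mult_prolongations prec L F D) \<and> Poly_Mapping.keys q \<subseteq> D"
  using red
proof (induction rule: rtranclp_induct)
  case base
  then show ?case using p by (simp add: mpol.span_zero)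
next
  case (step q q')
  then obtain f u v where f: "f \<in> F" "u \<in> Poly_Mapping.keys q" "v \<in> L (lm prec f) (lm prec ` F)"
    "u = lm prec f + v"
    and q': "q' = q - Poly_Mapping.single v (Poly_Mapping.lookup q u / lc prec f) * f"
    unfolding L_red_def by blast
  define c where "c = Poly_Mapping.lookup q u / lc prec f"
  have f0: "f \<noteq> 0" using f(1) F by auto
  then have c: "c \<noteq> 0" using f(2) lc_neq_0[OF adm f0] by (simp add: c_def in_keys_iff)
  have uD: "u \<in> D" using f(2) step.IH by blast
  have "mon_poly v * f \<in> mult_prolongations prec L F D"
    using f uD by (auto simp: mult_prolongations_def)
  then have "Poly_Mapping.single 0 c * (mon_poly v * f) \<in> mpol.span (mult_prolongations prec L F D)"
    by (intro mpol.span_scale mpol.span_base)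
  then have "Poly_Mapping.single v c * f \<in> mpol.span (mult_prolongations prec L F D)"
    by (simp add: mon_poly_def mult.assoc[symmetric] mult_single)
  moreover have "p - q' = (p - q) + Poly_Mapping.single v c * f"
    by (simp add: q' c_def)
  ultimately have "p - q' \<in> mpol.span (mult_prolongations prec L F D)"
    using step.IH mpol.span_add by metis
  moreover have "Poly_Mapping.keys (Poly_Mapping.single v c * f) \<subseteq> D"
  proof
    fix k assume k: "k \<in> Poly_Mapping.keys (Poly_Mapping.single v c * f)"
    have "k = u \<or> prec k u"
      using lm_props(2)[OF adm term_mult_neq_0[OF c f0] k] lm_term_mult[OF adm c f0, of v] f(4)
      by metis
    then show "k \<in> D" using D uD by blast
  qed
  then have "Poly_Mapping.keys q' \<subseteq> D"
    using step.IH unfolding q' c_def[symmetric]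
    by (auto simp: in_keys_iff lookup_minus subset_iff) (metis diff_0_right)
  ultimately show ?case by blast
qed

text \<open>
  The normal form of an element of the span stays in the span, and a nonzero element of the span
  has a term that can be reduced.
\<close>

lemma NF_eq_0_iff:
  fixes F :: "('n, 'k::field) mpol set"
  assumes "involutive_division L" "admissible_ordering prec" "L_autoreduced prec L F"
    and NF: "L_normal_form_algorithm prec L F NF"
  shows "NF p = 0 \<longleftrightarrow> p \<in> involutive_span prec L F"
proof -
  have F: "0 \<notin> F" using assms(3) by (simp add: L_autoreduced_def)
  have red: "(L_red prec L F)\<^sup>*\<^sup>* p (NF p)" and nf: "L_normal prec L F (NF p)"
    using NF by (auto simp: L_normal_form_algorithm_def)
  have diff: "p - NF p \<in> involutive_span prec L F"
    using reduction_chain_in_span[OF assms(2) F _ red, of UNIV] by simp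
  show ?thesis
  proof
    assume "NF p = 0"
    then show "p \<in> involutive_span prec L F" using diff by simp
  next
    assume "p \<in> involutive_span prec L F"
    then have mem: "NF p \<in> involutive_span prec L F"
      using mpol.span_diff[OF _ diff, of p] by simp
    show "NF p = 0"
    proof (rule ccontr)
      assume "NF p \<noteq> 0"
      then obtain b where b: "b \<in> mult_prolongations prec L F UNIV"
          "lm prec b \<in> Poly_Mapping.keys (NF p)"
        using span_lm_in_keys[OF assms(2) mult_prolongations_lm_inj(2,1)[OF assms(1-3)] mem] by blast
      then obtain f v where "b = mon_poly v * f" "f \<in> F" "v \<in> L (lm prec f) (lm prec ` F)"
        unfolding mult_prolongations_def by blast
      moreover from this have "lm prec b = lm prec f + v"
        using F lm_term_mult[OF assms(2), of 1 f v] by (auto simp: mon_poly_def)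
      ultimately show False using nf b(2) unfolding L_normal_def by metis
    qed
  qed
qed

section \<open>Transfer between polynomials with equal leading monomial\<close>

text \<open>
  Multiplying a multiplicative prolongation by \<open>s\<close> may leave its cone. The bound \<open>m\<close> keeps the
  result below \<open>m \<cdot> s\<close>, where all prolongations are assumed to lie in the span.
\<close>

lemma mon_poly_mult_in_span:
  fixes F :: "('n, 'k::field) mpol set"
  assumes below: "\<And>h u. h \<in> F \<Longrightarrow> prec (lm prec h + u) (m + s) \<Longrightarrow>
      h * mon_poly u \<in> involutive_span prec L F"
    and adm: "admissible_ordering prec"
    and p: "p \<in> mpol.span (mult_prolongations prec L F {u. prec u m})"
  shows "mon_poly s * p \<in> involutive_span prec L F"
  using p
proof (induction rule: mpol.span_induct_alt)
  case base
  then show ?case by (simp add: mpol.span_zero)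
next
  case (step c b y)
  then obtain f v where b: "b = mon_poly v * f" "f \<in> F" "prec (lm prec f + v) m"
    unfolding mult_prolongations_def by blast
  have "prec (lm prec f + (v + s)) (m + s)"
    using admissible_orderingD(3)[OF adm b(3), of s] by (simp add: add.assoc)
  then have "f * mon_poly (v + s) \<in> involutive_span prec L F" using below b(2) by blast
  moreover have "f * mon_poly (v + s) = mon_poly s * b"
    by (simp add: b(1) mon_poly_def mult_single mult.assoc[symmetric] add.commute mult.commute[of f])
  ultimately have "mon_poly s * b \<in> involutive_span prec L F" by simp
  then have "Poly_Mapping.single 0 c * (mon_poly s * b) + mon_poly s * y \<in> involutive_span prec L F"
    using step by (intro mpol.span_add mpol.span_scale)
  then show ?case by (simp add: distrib_left mult.left_commute)
qed

text \<open>
  Every comparison in the criterion is an instance of this lemma. The combination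
  \<open>lc q \<cdot> p - lc p \<cdot> q\<close> has only monomials below \<open>m\<close> and reduces to \<open>0\<close>; its reduction chain supplies
  the bounded representation that survives multiplication by \<open>s\<close>.
\<close>

lemma monomial_multiple_transfer:
  fixes F :: "('n, 'k::field) mpol set"
  assumes inv: "involutive_division L" and adm: "admissible_ordering prec"
    and auto: "L_autoreduced prec L F" and NF: "L_normal_form_algorithm prec L F NF"
    and below: "\<And>h u. h \<in> F \<Longrightarrow> prec (lm prec h + u) (m + s) \<Longrightarrow>
      h * mon_poly u \<in> involutive_span prec L F"
    and p: "p \<in> involutive_span prec L F" "p \<noteq> 0" "lm prec p = m"
    and q: "q \<in> involutive_span prec L F" "q \<noteq> 0" "lm prec q = m"
    and mem: "mon_poly s * p \<in> involutive_span prec L F"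
  shows "mon_poly s * q \<in> involutive_span prec L F"
proof -
  define d where "d = Poly_Mapping.single 0 (lc prec q) * p - Poly_Mapping.single 0 (lc prec p) * q"
  have lookup_d: "Poly_Mapping.lookup d u =
      lc prec q * Poly_Mapping.lookup p u - lc prec p * Poly_Mapping.lookup q u" for u
    by (simp add: d_def lookup_minus lookup_scalar_mult)
  have "Poly_Mapping.keys d \<subseteq> {u. prec u m}"
  proof
    fix u assume u: "u \<in> Poly_Mapping.keys d"
    then have "u \<noteq> m" using p(3) q(3) by (auto simp: in_keys_iff lookup_d lc_def)
    moreover have "u \<in> Poly_Mapping.keys p \<or> u \<in> Poly_Mapping.keys q"
      using u by (auto simp: in_keys_iff lookup_d)
    ultimately show "u \<in> {u. prec u m}"
      using lm_props(2)[OF adm p(2)] lm_props(2)[OF adm q(2)] p(3) q(3) by auto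
  qed
  moreover have "d \<in> involutive_span prec L F"
    unfolding d_def by (intro mpol.span_diff mpol.span_scale p q)
  then have "NF d = 0" using NF_eq_0_iff[OF inv adm auto NF] by simp
  then have "(L_red prec L F)\<^sup>*\<^sup>* d 0" using NF unfolding L_normal_form_algorithm_def by metis
  moreover have "0 \<notin> F" using auto by (simp add: L_autoreduced_def)
  ultimately have "d \<in> mpol.span (mult_prolongations prec L F {u. prec u m})"
    using reduction_chain_in_span[OF adm, of F "{u. prec u m}" L d 0]
      admissible_orderingD(2)[OF adm] by auto
  then have "mon_poly s * d \<in> involutive_span prec L F"
    using mon_poly_mult_in_span[OF below adm] by blast
  moreover have "Poly_Mapping.single 0 (lc prec p) * (mon_poly s * q) =
      Poly_Mapping.single 0 (lc prec q) * (mon_poly s * p) - mon_poly s * d"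
    by (simp add: d_def right_diff_distrib mult.left_commute)
  ultimately have "Poly_Mapping.single 0 (lc prec p) * (mon_poly s * q) \<in> involutive_span prec L F"
    using mem by (simp add: mpol.span_diff mpol.span_scale)
  then show ?thesis by (rule iffD1[OF span_scalar_mult_iff[OF lc_neq_0[OF adm p(2)]]])
qed

section \<open>The criterion\<close>

theorem theorem8p1:
  fixes prec :: "'n::{finite,linorder} mon \<Rightarrow> 'n mon \<Rightarrow> bool"
    and L :: "'n division"
    and F :: "('n, 'k::field_char_0) mpol set"
    and g :: "('n, 'k) mpol"
    and x :: 'n
    and NF :: "('n, 'k) mpol \<Rightarrow> ('n, 'k) mpol"
  assumes "involutive_division L"
    and "admissible_ordering prec"
    and "\<And>i j. i < j \<Longrightarrow> prec (var j) (var i)"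
    and "L_autoreduced prec L F"
    and "L_normal_form_algorithm prec L F NF"
    and "g \<in> F"
    and "x \<in> NM L (lm prec g) (lm prec ` F)"
    and "\<And>h u. h \<in> F \<Longrightarrow> prec (lm prec h + u) (lm prec (g * mon_poly (var x))) \<Longrightarrow>
           NF (h * mon_poly u) = 0"
    and "\<exists>f\<in>F. \<exists>f0\<in>F. \<exists>g0\<in>F.
           mon_dvd (lm prec f0) (lm prec f) \<and> mon_dvd (lm prec g0) (lm prec g) \<and>
           L_dvd L (lm prec ` F) (lm prec f) (lm prec (g * mon_poly (var x))) \<and>
           prec (mon_lcm (lm prec f0) (lm prec g0)) (lm prec (g * mon_poly (var x))) \<and>
           NF (f0 * lt_quot prec f f0) = 0 \<and> NF (g0 * lt_quot prec g g0) = 0"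
  shows "NF (g * mon_poly (var x)) = 0"
proof -
  note inv = assms(1) and adm = assms(2) and auto = assms(4) and NF = assms(5) and g = assms(6)
  let ?S = "involutive_span prec L F"
  note NF0 = NF_eq_0_iff[OF inv adm auto NF]
  define w where "w = lm prec (g * mon_poly (var x))"
  have F0: "h \<noteq> 0" if "h \<in> F" for h using auto that by (auto simp: L_autoreduced_def)
  have w: "w = lm prec g + var x"
    using lm_term_mult[OF adm, of 1 g "var x"] F0[OF g]
    by (simp add: w_def mon_poly_def mult.commute)
  have below: "h * mon_poly u \<in> ?S" if "h \<in> F" "prec (lm prec h + u) w" for h u
    using assms(8)[of h u] that by (simp add: NF0 w_def)
  have transfer: "mon_poly s * q \<in> ?S"
    if "p \<in> ?S" "p \<noteq> 0" "q \<in> ?S" "q \<noteq> 0" "lm prec p = lm prec q" "w = lm prec q + s"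
      "mon_poly s * p \<in> ?S" for p q s
    using monomial_multiple_transfer[OF inv adm auto NF, of "lm prec q" s p q] that below by blast
  have in_S: "h \<in> ?S" if h: "h \<in> F" for h
  proof -
    have "finite (lm prec ` F)" using auto by (simp add: L_autoreduced_def)
    then have "0 \<in> L (lm prec h) (lm prec ` F)"
      using involutive_divisionD(1)[OF inv] h by blast
    then have "mon_poly 0 * h \<in> ?S" by (rule mult_prolongation_in_span[OF h])
    then show ?thesis by (simp add: mon_poly_def)
  qed
  obtain f f0 g0 where fg: "f \<in> F" "f0 \<in> F" "g0 \<in> F"
    and dvd: "mon_dvd (lm prec f0) (lm prec f)" "mon_dvd (lm prec g0) (lm prec g)"
    and f_dvd: "L_dvd L (lm prec ` F) (lm prec f) w"
    and lcm: "prec (mon_lcm (lm prec f0) (lm prec g0)) w"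
    and quot: "f0 * lt_quot prec f f0 \<in> ?S" "g0 * lt_quot prec g g0 \<in> ?S"
    using assms(9) by (auto simp: NF0 w_def)
  define l where "l = mon_lcm (lm prec f0) (lm prec g0)"
  have f_dvd': "mon_dvd (lm prec f) w" and g_dvd: "mon_dvd (lm prec g) w"
    using f_dvd w by (auto simp: L_dvd_def mon_dvd_def)
  have l_dvd: "mon_dvd l w"
    unfolding l_def using mon_lcm_least(3) mon_dvd_trans dvd f_dvd' g_dvd by blast

  have quot_neq_0: "lc prec a / lc prec b \<noteq> 0" if "a \<in> F" "b \<in> F" for a b
    using that lc_neq_0[OF adm F0] by simp
  have lm_quot: "b * lt_quot prec a b \<noteq> 0 \<and> lm prec (b * lt_quot prec a b) = lm prec a"
    if "a \<in> F" "b \<in> F" "mon_dvd (lm prec b) (lm prec a)" for a b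
    using lm_term_mult[OF adm quot_neq_0[OF that(1,2)] F0[OF that(2)]]
      term_mult_neq_0[OF quot_neq_0[OF that(1,2)] F0[OF that(2)]] mon_dvd_add_diff[OF that(3)]
    by (simp add: lt_quot_def mult.commute)
  have mult_quot: "mon_poly (w - lm prec a) * (b * lt_quot prec a b) =
      Poly_Mapping.single 0 (lc prec a / lc prec b) * (b * mon_poly (w - lm prec b))"
    if "mon_dvd (lm prec b) (lm prec a)" "mon_dvd (lm prec a) w" for a b :: "('n, 'k) mpol"
    using mon_quotients_add[OF that]
    by (simp add: lt_quot_def mon_poly_def mult_single mult.left_commute[of _ b])

  \<comment> \<open>The prolongation of \<open>f\<close> to \<open>w\<close> is multiplicative, hence in the span for free.\<close>
  have "mon_poly (w - lm prec f) * f \<in> ?S"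
    using f_dvd mult_prolongation_in_span[OF fg(1)] by (auto simp: L_dvd_def)
  \<comment> \<open>From \<open>f\<close> to \<open>f0\<close>: compare at the monomial \<open>lm f\<close>.\<close>
  then have "mon_poly (w - lm prec f) * (f0 * lt_quot prec f f0) \<in> ?S"
    using transfer[of f "f0 * lt_quot prec f f0" "w - lm prec f"] in_S fg F0 quot(1)
      lm_quot[OF fg(1,2) dvd(1)] mon_dvd_add_diff[OF f_dvd'] by metis
  then have f0_w: "f0 * mon_poly (w - lm prec f0) \<in> ?S"
    by (simp add: mult_quot[OF dvd(1) f_dvd'] span_scalar_mult_iff[OF quot_neq_0[OF fg(1,2)]])

  \<comment> \<open>From \<open>f0\<close> to \<open>g0\<close>: compare at \<open>l\<close>, where both prolongations are below \<open>w\<close>.\<close>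
  have at_l: "h * mon_poly (l - lm prec h) \<in> ?S" "h * mon_poly (l - lm prec h) \<noteq> 0"
    "lm prec (h * mon_poly (l - lm prec h)) = l"
    "mon_poly (w - l) * (h * mon_poly (l - lm prec h)) = h * mon_poly (w - lm prec h)"
    if h: "h \<in> F" "mon_dvd (lm prec h) l" for h
  proof -
    note hl = mon_dvd_add_diff[OF h(2)]
    show "h * mon_poly (l - lm prec h) \<in> ?S"
      using below[OF h(1)] lcm hl by (simp add: l_def)
    show "h * mon_poly (l - lm prec h) \<noteq> 0" "lm prec (h * mon_poly (l - lm prec h)) = l"
      using term_mult_neq_0[of 1 h] lm_term_mult[OF adm, of 1 h] F0[OF h(1)] hl
      by (simp_all add: mon_poly_def mult.commute)
    have "(w - l) + (l - lm prec h) = w - lm prec h"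
      by (rule mon_quotients_add[OF h(2) l_dvd])
    then show "mon_poly (w - l) * (h * mon_poly (l - lm prec h)) = h * mon_poly (w - lm prec h)"
      by (simp add: mon_poly_def mult_single mult.left_commute[of _ h])
  qed
  have l: "mon_dvd (lm prec f0) l" "mon_dvd (lm prec g0) l"
    by (simp_all add: l_def mon_lcm_least)
  have "mon_poly (w - l) * (g0 * mon_poly (l - lm prec g0)) \<in> ?S"
    using f0_w at_l[OF fg(2) l(1)] at_l[OF fg(3) l(2)] mon_dvd_add_diff[OF l_dvd]
      transfer[of "f0 * mon_poly (l - lm prec f0)" "g0 * mon_poly (l - lm prec g0)" "w - l"]
    by metis
  then have "g0 * mon_poly (w - lm prec g0) \<in> ?S"
    by (simp add: at_l(4)[OF fg(3) l(2)])
  then have "mon_poly (w - lm prec g) * (g0 * lt_quot prec g g0) \<in> ?S"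
    unfolding mult_quot[OF dvd(2) g_dvd] by (rule mpol.span_scale)
  \<comment> \<open>From \<open>g0\<close> to \<open>g\<close>: compare at the monomial \<open>lm g\<close>.\<close>
  then have "mon_poly (w - lm prec g) * g \<in> ?S"
    using transfer[of "g0 * lt_quot prec g g0" g "w - lm prec g"] in_S g F0 quot(2)
      lm_quot[OF g fg(3) dvd(2)] mon_dvd_add_diff[OF g_dvd] by metis
  then show ?thesis by (simp add: NF0 w mult.commute)
qed

end
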